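(* For every fixed $p\in[1,\infty]$, Algorithm 3 (described in the context) is a $4$-approximation algorithm for Multilayer Correlation Clustering with the probability constraint: its output clustering $\mathcal{B}$ satisfies $\|(\mathsf{Disagree}_\ell(\mathcal{B}))_{\ell\in[L]}\|_p\le 4\cdot\mathrm{OPT}$, where $\mathrm{OPT}$ is the optimal value.
   Context: Multilayer Correlation Clustering: let $V$ be a finite set, $E=\{\{u,v\}:u,v\in V,u\ne v\}$, $L$ a positive integer, and for each layer $\ell\in[L]$ let $w^+_\ell,w^-_\ell:E\to\mathbb{R}_{\ge0}$ with the probability constraint $w^+_\ell(u,v)+w^-_\ell(u,v)=1$ for all $\ell$ and $\{u,v\}\in E$. For a clustering (partition) $\mathcal{C}$ of $V$, with $\mathcal{C}(v)$ the cluster containing $v$, $\mathsf{Disagree}_\ell(\mathcal{C})=\sum_{\{u,v\}\in E}\big(w^+_\ell(u,v)\mathbf{1}[\mathcal{C}(u)\ne\mathcal{C}(v)]+w^-_\ell(u,v)\mathbf{1}[\mathcal{C}(u)=\mathcal{C}(v)]\big)$; the goal is to minimize the $\ell_p$-norm of $(\mathsf{Disagree}_\ell(\mathcal{C}))_{\ell\in[L]}$. Relaxations: with variables $x_{ij}$ for distinct $i,j\in V$ subject to $x_{ij}=x_{ji}$, $x_{ik}\le x_{ij}+x_{jk}$ for all pairwise distinct $i,j,k$, and $x_{ij}\in[0,1]$: (CV-Pr) (for $p<\infty$) minimizes $\big(\sum_{\ell\in[L]}\big(\sum_{\{i,j\}\in E}(w^+_\ell(i,j)x_{ij}+w^-_\ell(i,j)(1-x_{ij}))\big)^p\big)^{1/p}$;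 (LP-Pr) (for $p=\infty$) minimizes $t$ subject additionally to $\sum_{\{i,j\}\in E}(w^+_\ell(i,j)x_{ij}+w^-_\ell(i,j)(1-x_{ij}))\le t$ for all $\ell$. It is assumed (standing assumption of the paper) that (CV-Pr) can be solved exactly. Algorithm 3: compute an optimal solution $x^*$ of (CV-Pr) if $p<\infty$ or (LP-Pr) if $p=\infty$; set $x^*_{ii}=0$ for all $i$. For $\widehat V\subseteq V$, $i\in\widehat V$, $r\ge0$ let $B_{\widehat V}(i,r)=\{j\in\widehat V:x^*_{ij}\le r\}$. Set $\mathcal{B}=\emptyset$, $\widehat V=V$. While $\widehat V\ne\emptyset$: take an arbitrary $i\in\widehat V$, set $B=\{i\}$ and $C=B_{\widehat V}(i,1/2)\setminus\{i\}$; if $\frac{1}{|C|}\sum_{j\in C}x^*_{ij}<1/4$ then set $B=B\cup C$ (if $C=\emptyset$, $B=\{i\}$); add $B$ to $\mathcal{B}$ and set $\widehat V=\widehat V\setminus B$. Output $\mathcal{B}$. *)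

theory Defs
  imports "HOL-Analysis.Analysis"
begin

definition edges :: "'a set \<Rightarrow> 'a set set" where
  "edges V = {{u, v} |u v. u \<in> V \<and> v \<in> V \<and> u \<noteq> v}"

text \<open>The value on an unordered pair of a function of two arguments; only meaningful if the
  function is symmetric on that pair.\<close>

definition on_edge :: "('a \<Rightarrow> 'a \<Rightarrow> real) \<Rightarrow> 'a set \<Rightarrow> real" where
  "on_edge f e = (THE r. \<exists>u v. u \<noteq> v \<and> e = {u, v} \<and> r = f u v)"

lemma on_edge_eq:
  assumes "u \<noteq> v" and "f u v = f v u"
  shows "on_edge f {u, v} = f u v"
  unfolding on_edge_def
proof (rule the_equality)
  show "\<exists>u' v'. u' \<noteq> v' \<and> {u, v} = {u', v'} \<and> f u v = f u' v'"
    using assms by blast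
next
  fix r assume "\<exists>u' v'. u' \<noteq> v' \<and> {u, v} = {u', v'} \<and> r = f u' v'"
  then show "r = f u v"
    using assms by (auto simp: doubleton_eq_iff)
qed

text \<open>Layers are indexed by \<open>{1..L}\<close>; \<open>wp \<ell> e\<close> and \<open>wm \<ell> e\<close> are the weights
  $w^+_\ell(e)$ and $w^-_\ell(e)$.\<close>

definition probability_instance ::
  "'a set \<Rightarrow> nat \<Rightarrow> (nat \<Rightarrow> 'a set \<Rightarrow> real) \<Rightarrow> (nat \<Rightarrow> 'a set \<Rightarrow> real) \<Rightarrow> bool" where
  "probability_instance V L wp wm \<longleftrightarrow>
     finite V \<and> L \<ge> 1 \<and>
     (\<forall>l\<in>{1..L}. \<forall>e\<in>edges V. wp l e \<ge> 0 \<and> wm l e \<ge> 0 \<and> wp l e + wm l e = 1)"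

definition cluster_of :: "'a set set \<Rightarrow> 'a \<Rightarrow> 'a set" where
  "cluster_of C v = (THE X. X \<in> C \<and> v \<in> X)"

definition disagree ::
  "'a set \<Rightarrow> (nat \<Rightarrow> 'a set \<Rightarrow> real) \<Rightarrow> (nat \<Rightarrow> 'a set \<Rightarrow> real) \<Rightarrow> 'a set set \<Rightarrow> nat \<Rightarrow> real" where
  "disagree V wp wm C l =
     (\<Sum>e\<in>edges V.
        wp l e * on_edge (\<lambda>u v. of_bool (cluster_of C u \<noteq> cluster_of C v)) e +
        wm l e * on_edge (\<lambda>u v. of_bool (cluster_of C u = cluster_of C v)) e)"

definition lp_norm :: "ereal \<Rightarrow> nat \<Rightarrow> (nat \<Rightarrow> real) \<Rightarrow> real" where
  "lp_norm p L d =
     (if p = \<infinity> then Max ((\<lambda>l. \<bar>d l\<bar>) ` {1..L})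
      else (\<Sum>l\<in>{1..L}. \<bar>d l\<bar> powr real_of_ereal p) powr (1 / real_of_ereal p))"

text \<open>The minimum is over a finite nonempty set whenever \<open>V\<close> is finite.\<close>

definition opt_value ::
  "ereal \<Rightarrow> 'a set \<Rightarrow> nat \<Rightarrow> (nat \<Rightarrow> 'a set \<Rightarrow> real) \<Rightarrow> (nat \<Rightarrow> 'a set \<Rightarrow> real) \<Rightarrow> real" where
  "opt_value p V L wp wm =
     Min ((\<lambda>C. lp_norm p L (disagree V wp wm C)) ` {C. partition_on V C})"

text \<open>The constraints common to both relaxations. They concern distinct indices only; diagonal
  values are unconstrained.\<close>

definition relax_feasible :: "'a set \<Rightarrow> ('a \<Rightarrow> 'a \<Rightarrow> real) \<Rightarrow> bool" where
  "relax_feasible V x \<longleftrightarrow>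
     (\<forall>i\<in>V. \<forall>j\<in>V. i \<noteq> j \<longrightarrow> x i j = x j i \<and> 0 \<le> x i j \<and> x i j \<le> 1) \<and>
     (\<forall>i\<in>V. \<forall>j\<in>V. \<forall>k\<in>V. i \<noteq> j \<and> j \<noteq> k \<and> i \<noteq> k \<longrightarrow> x i k \<le> x i j + x j k)"

definition relax_cost ::
  "'a set \<Rightarrow> (nat \<Rightarrow> 'a set \<Rightarrow> real) \<Rightarrow> (nat \<Rightarrow> 'a set \<Rightarrow> real) \<Rightarrow> ('a \<Rightarrow> 'a \<Rightarrow> real) \<Rightarrow> nat \<Rightarrow> real" where
  "relax_cost V wp wm x l =
     (\<Sum>e\<in>edges V. wp l e * on_edge x e + wm l e * (1 - on_edge x e))"

definition cv_objective ::
  "real \<Rightarrow> 'a set \<Rightarrow> nat \<Rightarrow> (nat \<Rightarrow> 'a set \<Rightarrow> real) \<Rightarrow> (nat \<Rightarrow> 'a set \<Rightarrow> real) \<Rightarrow>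
     ('a \<Rightarrow> 'a \<Rightarrow> real) \<Rightarrow> real" where
  "cv_objective q V L wp wm x = (\<Sum>l\<in>{1..L}. relax_cost V wp wm x l powr q) powr (1 / q)"

definition cv_optimal ::
  "real \<Rightarrow> 'a set \<Rightarrow> nat \<Rightarrow> (nat \<Rightarrow> 'a set \<Rightarrow> real) \<Rightarrow> (nat \<Rightarrow> 'a set \<Rightarrow> real) \<Rightarrow>
     ('a \<Rightarrow> 'a \<Rightarrow> real) \<Rightarrow> bool" where
  "cv_optimal q V L wp wm x \<longleftrightarrow>
     relax_feasible V x \<and>
     (\<forall>y. relax_feasible V y \<longrightarrow> cv_objective q V L wp wm x \<le> cv_objective q V L wp wm y)"

definition lp_feasible ::
  "'a set \<Rightarrow> nat \<Rightarrow> (nat \<Rightarrow> 'a set \<Rightarrow> real) \<Rightarrow> (nat \<Rightarrow> 'a set \<Rightarrow> real) \<Rightarrow>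
     ('a \<Rightarrow> 'a \<Rightarrow> real) \<Rightarrow> real \<Rightarrow> bool" where
  "lp_feasible V L wp wm x t \<longleftrightarrow>
     relax_feasible V x \<and> (\<forall>l\<in>{1..L}. relax_cost V wp wm x l \<le> t)"

definition lp_optimal ::
  "'a set \<Rightarrow> nat \<Rightarrow> (nat \<Rightarrow> 'a set \<Rightarrow> real) \<Rightarrow> (nat \<Rightarrow> 'a set \<Rightarrow> real) \<Rightarrow>
     ('a \<Rightarrow> 'a \<Rightarrow> real) \<Rightarrow> real \<Rightarrow> bool" where
  "lp_optimal V L wp wm x t \<longleftrightarrow>
     lp_feasible V L wp wm x t \<and> (\<forall>y s. lp_feasible V L wp wm y s \<longrightarrow> t \<le> s)"

definition relax_optimal ::
  "ereal \<Rightarrow> 'a set \<Rightarrow> nat \<Rightarrow> (nat \<Rightarrow> 'a set \<Rightarrow> real) \<Rightarrow> (nat \<Rightarrow> 'a set \<Rightarrow> real) \<Rightarrow>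
     ('a \<Rightarrow> 'a \<Rightarrow> real) \<Rightarrow> bool" where
  "relax_optimal p V L wp wm x \<longleftrightarrow>
     (if p = \<infinity> then \<exists>t. lp_optimal V L wp wm x t
      else cv_optimal (real_of_ereal p) V L wp wm x)"

definition zero_diag :: "('a \<Rightarrow> 'a \<Rightarrow> real) \<Rightarrow> 'a \<Rightarrow> 'a \<Rightarrow> real" where
  "zero_diag x i j = (if i = j then 0 else x i j)"

definition relax_ball :: "('a \<Rightarrow> 'a \<Rightarrow> real) \<Rightarrow> 'a set \<Rightarrow> 'a \<Rightarrow> real \<Rightarrow> 'a set" where
  "relax_ball x U i r = {j \<in> U. x i j \<le> r}"

text \<open>If \<open>C = {}\<close>, both branches give \<open>{i}\<close>.\<close>

definition pivot_cluster :: "('a \<Rightarrow> 'a \<Rightarrow> real) \<Rightarrow> 'a set \<Rightarrow> 'a \<Rightarrow> 'a set" where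
  "pivot_cluster x U i =
     (let C = relax_ball x U i (1/2) - {i} in
      if (\<Sum>j\<in>C. x i j) / real (card C) < 1/4 then {i} \<union> C else {i})"

text \<open>One iteration of the while loop, on states consisting of the clusters found so far and the
  vertices remaining. The arbitrary choice of the pivot makes this a relation.\<close>

inductive rounding_step ::
  "('a \<Rightarrow> 'a \<Rightarrow> real) \<Rightarrow> 'a set set \<times> 'a set \<Rightarrow> 'a set set \<times> 'a set \<Rightarrow> bool"
  for x :: "'a \<Rightarrow> 'a \<Rightarrow> real" where
  "i \<in> U \<Longrightarrow> B = pivot_cluster x U i \<Longrightarrow> rounding_step x (Bs, U) (insert B Bs, U - B)"

text \<open>\<open>Bs\<close> is a possible output of the algorithm, for some choice of an optimal solution of the
  relaxation and of the pivots.\<close>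

definition algorithm_output ::
  "ereal \<Rightarrow> 'a set \<Rightarrow> nat \<Rightarrow> (nat \<Rightarrow> 'a set \<Rightarrow> real) \<Rightarrow> (nat \<Rightarrow> 'a set \<Rightarrow> real) \<Rightarrow>
     'a set set \<Rightarrow> bool" where
  "algorithm_output p V L wp wm Bs \<longleftrightarrow>
     (\<exists>x. relax_optimal p V L wp wm x \<and>
          (rounding_step (zero_diag x))\<^sup>*\<^sup>* ({}, V) (Bs, {}))"

end

theory Submission
  imports Defs
begin

text \<open>Fix a feasible \<open>x\<close> and write \<open>c(e)\<close> for the fractional cost of a pair \<open>e\<close> in one layer.
  For every pivot \<open>i\<close>, the disagreements decided in that iteration are at most four times the
  fractional cost of the same pairs, layer by layer. Any two vertices \<open>j, k\<close> satisfy
  \<open>c(j,k) \<ge> w\<^sup>+(j,k) (x\<^sub>i\<^sub>k - x\<^sub>i\<^sub>j) + w\<^sup>-(j,k) (1 - x\<^sub>i\<^sub>k - x\<^sub>i\<^sub>j)\<close>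
  by the triangle inequality. If the values \<open>x\<^sub>i\<^sub>j\<close> over a set of vertices \<open>j\<close> average to at most
  \<open>1/4\<close>, then by the probability constraint summing gives at least
  \<open>\<Sum>\<^sub>j w\<^sup>+(j,k) (x\<^sub>i\<^sub>k - 1/4) + w\<^sup>-(j,k) (3/4 - x\<^sub>i\<^sub>k)\<close>. This pays for the pairs cut when
  \<open>1/2 \<le> x\<^sub>i\<^sub>k \<le> 3/4\<close>, and for the pairs joined when \<open>3/8 \<le> x\<^sub>i\<^sub>k \<le> 1/2\<close>; in the remaining ranges each
  pair pays for itself. If the average is at least \<open>1/4\<close> and \<open>i\<close> stays alone, its cut pairs within
  distance \<open>1/2\<close> are paid for because \<open>c(i,j) \<ge> x\<^sub>i\<^sub>j\<close> there. The relaxation attains its minimum by compactness, and clusterings are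
  its integral points.\<close>

section \<open>Sums over unordered pairs\<close>

lemma edges_empty [simp]: "edges {} = {}"
  by (auto simp: edges_def)

lemma edges_singleton [simp]: "edges {i} = {}"
  by (auto simp: edges_def)

lemma edgesI: "u \<in> V \<Longrightarrow> v \<in> V \<Longrightarrow> u \<noteq> v \<Longrightarrow> {u, v} \<in> edges V"
  by (auto simp: edges_def)

lemma edgesE:
  assumes "e \<in> edges V"
  obtains u v where "e = {u, v}" "u \<in> V" "v \<in> V" "u \<noteq> v"
  using assms by (auto simp: edges_def)

lemma finite_edges: "finite V \<Longrightarrow> finite (edges V)"
  by (rule finite_subset[of _ "Pow V"]) (auto simp: edges_def)

text \<open>A pair in a disjoint union lies in one part or crosses, and disjointness makes
  \<open>(k, j)\<close> recoverable from a crossing pair. It serves to add one vertex to a set and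
  to split off one cluster.\<close>

lemma sum_edges_Un:
  fixes f :: "'a set \<Rightarrow> real"
  assumes "finite A" "finite B" "A \<inter> B = {}"
  shows "sum f (edges (A \<union> B)) =
    sum f (edges A) + sum f (edges B) + (\<Sum>k\<in>B. \<Sum>j\<in>A. f {j, k})"
proof -
  define X where "X = (\<lambda>(k, j). {j, k}) ` (B \<times> A)"
  have split: "edges (A \<union> B) = (edges A \<union> edges B) \<union> X"
  proof
    show "edges (A \<union> B) \<subseteq> (edges A \<union> edges B) \<union> X"
    proof
      fix e assume "e \<in> edges (A \<union> B)"
      then obtain u v where e: "e = {u, v}" "u \<in> A \<union> B" "v \<in> A \<union> B" "u \<noteq> v"
        by (rule edgesE)
      have "e \<in> X" if "j \<in> A" "k \<in> B" "e = {j, k}" for j k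
        using that unfolding X_def by force
      with e show "e \<in> (edges A \<union> edges B) \<union> X"
        by (metis Un_iff edgesI insert_commute)
    qed
    show "(edges A \<union> edges B) \<union> X \<subseteq> edges (A \<union> B)"
      using assms(3) by (auto simp: edges_def X_def) blast+
  qed
  have fin: "finite (edges A)" "finite (edges B)" "finite X"
    using assms by (auto simp: finite_edges X_def)
  have disj: "edges A \<inter> edges B = {}" "(edges A \<union> edges B) \<inter> X = {}"
    using assms(3) by (auto simp: edges_def X_def doubleton_eq_iff)
  have inj: "inj_on (\<lambda>(k, j). {j, k}) (B \<times> A)"
    using assms(3) by (auto simp: inj_on_def doubleton_eq_iff)
  have "sum f X = (\<Sum>k\<in>B. \<Sum>j\<in>A. f {j, k})"
    unfolding X_def sum.reindex[OF inj] sum.cartesian_product by (simp add: o_def split_def)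
  then show ?thesis
    unfolding split using fin disj by (simp add: sum.union_disjoint)
qed

section \<open>Rounding one layer\<close>

text \<open>The triangle inequality here includes repeated indices, which is where the zero diagonal
  enters. Of \<open>x\<close> only feasibility is kept, so one \<open>x\<close> can serve all
  layers.\<close>

locale fractional_layer =
  fixes V :: "'a set" and x :: "'a \<Rightarrow> 'a \<Rightarrow> real" and wp wm :: "'a set \<Rightarrow> real"
  assumes fin: "finite V"
    and diag: "x i i = 0"
    and sym: "i \<in> V \<Longrightarrow> j \<in> V \<Longrightarrow> x i j = x j i"
    and nonneg: "i \<in> V \<Longrightarrow> j \<in> V \<Longrightarrow> 0 \<le> x i j"
    and le_one: "i \<in> V \<Longrightarrow> j \<in> V \<Longrightarrow> x i j \<le> 1"
    and triangle: "i \<in> V \<Longrightarrow> j \<in> V \<Longrightarrow> k \<in> V \<Longrightarrow> x i k \<le> x i j + x j k"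
    and wp_nonneg: "e \<in> edges V \<Longrightarrow> 0 \<le> wp e"
    and wm_nonneg: "e \<in> edges V \<Longrightarrow> 0 \<le> wm e"
    and w_sum: "e \<in> edges V \<Longrightarrow> wp e + wm e = 1"
begin

definition frac_cost :: "'a set \<Rightarrow> real" where
  "frac_cost e = wp e * on_edge x e + wm e * (1 - on_edge x e)"

lemma frac_cost_eq:
  assumes "j \<in> V" "k \<in> V" "j \<noteq> k"
  shows "frac_cost {j, k} = wp {j, k} * x j k + wm {j, k} * (1 - x j k)"
  using on_edge_eq[of j k x] sym[of j k] assms by (simp add: frac_cost_def)

lemma wp_le_frac_cost:
  assumes "j \<in> V" "k \<in> V" "j \<noteq> k" "1/4 \<le> x j k"
  shows "wp {j, k} \<le> 4 * frac_cost {j, k}"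
proof -
  have "wp {j, k} * (1/4) \<le> wp {j, k} * x j k"
    using assms by (intro mult_left_mono wp_nonneg edgesI) auto
  moreover have "0 \<le> wm {j, k} * (1 - x j k)"
    using assms by (intro mult_nonneg_nonneg wm_nonneg edgesI) (auto simp: le_one)
  ultimately show ?thesis
    by (simp add: frac_cost_eq assms)
qed

lemma wm_le_frac_cost:
  assumes "j \<in> V" "k \<in> V" "j \<noteq> k" "x j k \<le> 3/4"
  shows "wm {j, k} \<le> 4 * frac_cost {j, k}"
proof -
  have "wm {j, k} * (1/4) \<le> wm {j, k} * (1 - x j k)"
    using assms by (intro mult_left_mono wm_nonneg edgesI) auto
  moreover have "0 \<le> wp {j, k} * x j k"
    using assms by (intro mult_nonneg_nonneg wp_nonneg edgesI) (auto simp: nonneg)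
  ultimately show ?thesis
    by (simp add: frac_cost_eq assms)
qed

text \<open>A single pair may violate its share of the bound; only the sum over \<open>T\<close> is
  controlled, because distances \<open>x i j\<close> above \<open>1/4\<close> are offset by smaller
  ones.\<close>

lemma star_cost:
  assumes T: "T \<subseteq> V" and i: "i \<in> V" and k: "k \<in> V" "k \<notin> T"
    and avg: "(\<Sum>j\<in>T. x i j) \<le> real (card T) / 4"
  shows "(\<Sum>j\<in>T. wp {j, k} * (x i k - 1/4) + wm {j, k} * (3/4 - x i k))
    \<le> (\<Sum>j\<in>T. frac_cost {j, k})"
proof -
  \<comment> \<open>The average bound makes the added slack nonnegative; it is then shared out,
    \<open>1/4 - x i j\<close> to each \<open>j\<close>.\<close>
  have "(\<Sum>j\<in>T. wp {j, k} * (x i k - 1/4) + wm {j, k} * (3/4 - x i k))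
      \<le> (\<Sum>j\<in>T. wp {j, k} * (x i k - 1/4) + wm {j, k} * (3/4 - x i k)) +
        (real (card T) / 4 - (\<Sum>j\<in>T. x i j))"
    using avg by simp
  also have "\<dots> = (\<Sum>j\<in>T. wp {j, k} * (x i k - 1/4) + wm {j, k} * (3/4 - x i k) + (1/4 - x i j))"
    by (simp add: sum.distrib sum_subtractf)
  also have "\<dots> \<le> (\<Sum>j\<in>T. frac_cost {j, k})"
  proof (rule sum_mono)
    fix j assume "j \<in> T"
    with T k have j: "j \<in> V" "j \<noteq> k" by auto
    then have e: "{j, k} \<in> edges V"
      using k by (intro edgesI)
    have "x i k \<le> x i j + x j k" and "x j k \<le> x i j + x i k"
      using triangle[of i j k] triangle[of j i k] sym[of i j] i j k by auto
    then have "wp {j, k} * (x i k - x i j) \<le> wp {j, k} * x j k"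
      and "wm {j, k} * (1 - x i j - x i k) \<le> wm {j, k} * (1 - x j k)"
      using wp_nonneg[OF e] wm_nonneg[OF e] by (auto intro!: mult_left_mono)
    \<comment> \<open>Splitting \<open>1/4 - x i j\<close> in the proportions \<open>wp\<close> and
      \<open>wm\<close>, which add up to 1, turns both coefficients into the triangle
      bounds.\<close>
    moreover have "wp {j, k} * (x i k - 1/4) + wm {j, k} * (3/4 - x i k) + (1/4 - x i j)
        = wp {j, k} * (x i k - x i j) + wm {j, k} * (1 - x i j - x i k)"
    proof -
      have wm_eq: "wm {j, k} = 1 - wp {j, k}"
        using w_sum[OF e] by simp
      show ?thesis
        unfolding wm_eq by (simp add: field_simps)
    qed
    ultimately show "wp {j, k} * (x i k - 1/4) + wm {j, k} * (3/4 - x i k) + (1/4 - x i j)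
        \<le> frac_cost {j, k}"
      using j k by (simp add: frac_cost_eq)
  qed
  finally show ?thesis .
qed

text \<open>For \<open>x i k\<close> between \<open>1/2\<close> and \<open>3/4\<close>, the
  coefficient of \<open>wp\<close> in \<open>star_cost\<close> is at least \<open>1/4\<close> and
  that of \<open>wm\<close> is nonnegative. Beyond \<open>3/4\<close>, every \<open>j\<close> in
  \<open>T\<close> has \<open>x j k > 1/4\<close>, so each pair pays for itself.\<close>

lemma cut_cost:
  assumes T: "T \<subseteq> V" and i: "i \<in> V" and k: "k \<in> V" "k \<notin> T"
    and avg: "(\<Sum>j\<in>T. x i j) \<le> real (card T) / 4"
    and near: "\<And>j. j \<in> T \<Longrightarrow> x i j \<le> 1/2" and far: "1/2 \<le> x i k"
  shows "(\<Sum>j\<in>T. wp {j, k}) \<le> 4 * (\<Sum>j\<in>T. frac_cost {j, k})"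
proof (cases "x i k \<le> 3/4")
  case True
  have "(\<Sum>j\<in>T. wp {j, k} / 4)
      \<le> (\<Sum>j\<in>T. wp {j, k} * (x i k - 1/4) + wm {j, k} * (3/4 - x i k))"
  proof (rule sum_mono)
    fix j assume "j \<in> T"
    then have e: "{j, k} \<in> edges V"
      using T k by (intro edgesI) auto
    have "wp {j, k} * (1/4) \<le> wp {j, k} * (x i k - 1/4)"
      using wp_nonneg[OF e] far by (intro mult_left_mono) auto
    moreover have "0 \<le> wm {j, k} * (3/4 - x i k)"
      using wm_nonneg[OF e] True by simp
    ultimately show "wp {j, k} / 4 \<le> wp {j, k} * (x i k - 1/4) + wm {j, k} * (3/4 - x i k)"
      by simp
  qed
  also note star_cost[OF T i k avg]
  finally show ?thesis
    by (simp flip: sum_divide_distrib)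
next
  case False
  have "wp {j, k} \<le> 4 * frac_cost {j, k}" if "j \<in> T" for j
    using that False near[of j] triangle[of i j k] T i k by (intro wp_le_frac_cost) auto
  then show ?thesis
    unfolding sum_distrib_left by (rule sum_mono)
qed

text \<open>Vertices are inserted by increasing distance from \<open>i\<close>, so \<open>k\<close>
  is a farthest one and its pairs to the earlier vertices form a star for
  \<open>star_cost\<close>.\<close>

lemma joined_cost:
  assumes "finite T" "T \<subseteq> V" "i \<in> V"
    and "(\<Sum>j\<in>T. x i j) \<le> real (card T) / 4"
    and "\<And>j. j \<in> T \<Longrightarrow> x i j \<le> 1/2"
  shows "sum wm (edges T) \<le> 4 * sum frac_cost (edges T)"
  using assms
proof (induction T rule: finite_ranking_induct[where f = "x i"])
  case empty
  then show ?case by simp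
next
  case (insert k S)
  show ?case
  \<comment> \<open>The ranking induction does not guarantee that the inserted vertex is
    new.\<close>
  proof (cases "k \<in> S")
    case True
    then show ?thesis
      using insert by (simp add: insert_absorb)
  next
    case False
    have k: "k \<in> V" and S: "S \<subseteq> V"
      using insert.prems by auto
    have avg: "(\<Sum>j\<in>S. x i j) \<le> real (card S) / 4"
    \<comment> \<open>Removing a farthest vertex keeps the average at most \<open>1/4\<close>:
      either all distances are at most \<open>1/4\<close>, or the removed one exceeds
      \<open>1/4\<close>.\<close>
    proof (cases "x i k \<le> 1/4")
      case True
      then have "(\<Sum>j\<in>S. x i j) \<le> (\<Sum>j\<in>S. 1/4)"
        using insert.hyps by (intro sum_mono) fastforce
      then show ?thesis by simp
    next
      case False
      then show ?thesis
        using insert.prems(3) insert.hyps \<open>k \<notin> S\<close> by simp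
    qed
    have IH: "sum wm (edges S) \<le> 4 * sum frac_cost (edges S)"
      using insert.IH S insert.prems avg by simp
    have "(\<Sum>j\<in>S. wm {j, k}) \<le> 4 * (\<Sum>j\<in>S. frac_cost {j, k})"
    \<comment> \<open>Up to \<open>3/8\<close>, maximality of \<open>x i k\<close> gives
      \<open>x j k \<le> 3/4\<close>, so each pair pays for itself. Above it,
      \<open>x i k \<le> 1/2\<close> makes the coefficient of \<open>wm\<close> in
      \<open>star_cost\<close> at least \<open>1/4\<close>.\<close>
    proof (cases "x i k \<le> 3/8")
      case True
      have "wm {j, k} \<le> 4 * frac_cost {j, k}" if "j \<in> S" for j
        using that True False insert.hyps(2)[of j] triangle[of j i k] sym[of i j] S k insert.prems
        by (intro wm_le_frac_cost) auto
      then show ?thesis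
        unfolding sum_distrib_left by (rule sum_mono)
    next
      case F: False
      have half: "x i k \<le> 1/2"
        using insert.prems by simp
      have "(\<Sum>j\<in>S. wm {j, k} / 4)
          \<le> (\<Sum>j\<in>S. wp {j, k} * (x i k - 1/4) + wm {j, k} * (3/4 - x i k))"
      proof (rule sum_mono)
        fix j assume "j \<in> S"
        then have e: "{j, k} \<in> edges V"
          using S k False by (intro edgesI) auto
        have "wm {j, k} * (1/4) \<le> wm {j, k} * (3/4 - x i k)"
          using wm_nonneg[OF e] half by (intro mult_left_mono) auto
        moreover have "0 \<le> wp {j, k} * (x i k - 1/4)"
          using wp_nonneg[OF e] F by simp
        ultimately show "wm {j, k} / 4 \<le> wp {j, k} * (x i k - 1/4) + wm {j, k} * (3/4 - x i k)"
          by simp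
      qed
      also note star_cost[OF S insert.prems(2) k False avg]
      finally show ?thesis
        by (simp flip: sum_divide_distrib)
    qed
    with IH show ?thesis
      using sum_edges_Un[of S "{k}" wm] sum_edges_Un[of S "{k}" frac_cost] insert.hyps(1) False
      by simp
  qed
qed

lemma singleton_cost:
  assumes U: "U \<subseteq> V" and i: "i \<in> U"
    and avg: "real (card (relax_ball x U i (1/2) - {i})) / 4
      \<le> (\<Sum>j\<in>relax_ball x U i (1/2) - {i}. x i j)"
  shows "(\<Sum>k\<in>U - {i}. wp {i, k}) \<le> 4 * (\<Sum>k\<in>U - {i}. frac_cost {i, k})"
proof -
  define C where "C = relax_ball x U i (1/2) - {i}"
  have finU: "finite U"
    using U fin by (rule finite_subset)
  have CU: "C \<subseteq> U - {i}"
    by (auto simp: C_def relax_ball_def)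
  have e: "{i, k} \<in> edges V" if "k \<in> U - {i}" for k
    using that U i by (intro edgesI) auto
  have "(\<Sum>k\<in>C. wp {i, k}) \<le> (\<Sum>k\<in>C. 1)"
    using CU e wm_nonneg w_sum by (intro sum_mono) (smt (verit) subsetD)
  also have "\<dots> \<le> 4 * (\<Sum>k\<in>C. x i k)"
    using avg by (simp add: C_def)
  also have "(\<Sum>k\<in>C. x i k) \<le> (\<Sum>k\<in>C. frac_cost {i, k})"
  proof (rule sum_mono)
    fix k assume k: "k \<in> C"
    then have kV: "k \<in> V" "i \<noteq> k" "i \<in> V" and half: "x i k \<le> 1/2"
      using CU U i by (auto simp: C_def relax_ball_def)
    have E: "{i, k} \<in> edges V"
      using kV by (intro edgesI)
    \<comment> \<open>Within distance \<open>1/2\<close>, the cost is a convex combination of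
      \<open>x i k\<close> and the larger \<open>1 - x i k\<close>.\<close>
    have "wm {i, k} * x i k \<le> wm {i, k} * (1 - x i k)"
      using wm_nonneg[OF E] half by (intro mult_left_mono) auto
    moreover have "x i k = wp {i, k} * x i k + wm {i, k} * x i k"
      using w_sum[OF E] by (metis distrib_right mult_1)
    ultimately show "x i k \<le> frac_cost {i, k}"
      using kV by (simp add: frac_cost_eq)
  qed
  finally have near: "(\<Sum>k\<in>C. wp {i, k}) \<le> 4 * (\<Sum>k\<in>C. frac_cost {i, k})"
    by simp
  have "wp {i, k} \<le> 4 * frac_cost {i, k}" if "k \<in> U - {i} - C" for k
    using that U i by (intro wp_le_frac_cost) (auto simp: C_def relax_ball_def)
  then have "(\<Sum>k\<in>U - {i} - C. wp {i, k}) \<le> 4 * (\<Sum>k\<in>U - {i} - C. frac_cost {i, k})"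
    unfolding sum_distrib_left by (rule sum_mono)
  with near show ?thesis
    using sum.subset_diff[OF CU, of "\<lambda>k. wp {i, k}"]
      sum.subset_diff[OF CU, of "\<lambda>k. frac_cost {i, k}"] finU by simp
qed

text \<open>The pairs decided in one iteration are those inside \<open>S\<close> and those from
  \<open>S\<close> to the remaining vertices. No later iteration charges them again.\<close>

lemma pivot_cost:
  assumes U: "U \<subseteq> V" and i: "i \<in> U"
  defines "S \<equiv> pivot_cluster x U i"
  shows "sum wm (edges S) + (\<Sum>k\<in>U - S. \<Sum>j\<in>S. wp {j, k})
    \<le> 4 * (sum frac_cost (edges S) + (\<Sum>k\<in>U - S. \<Sum>j\<in>S. frac_cost {j, k}))"
proof -
  define C where "C = relax_ball x U i (1/2) - {i}"
  have finC: "finite C"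
    using U fin by (auto simp: C_def relax_ball_def intro: finite_subset)
  show ?thesis
  proof (cases "(\<Sum>j\<in>C. x i j) / real (card C) < 1/4")
    case True
    then have S: "S = insert i C"
      by (simp add: S_def pivot_cluster_def C_def Let_def)
    have SV: "S \<subseteq> V" and iV: "i \<in> V" and iC: "i \<notin> C" and finS: "finite S"
      using U i finC by (auto simp: S C_def relax_ball_def)
    \<comment> \<open>An empty \<open>C\<close> also lands in this branch, since
      \<open>0 / 0 = 0\<close>.\<close>
    have "(\<Sum>j\<in>C. x i j) \<le> real (card C) / 4"
      using True finC by (cases "C = {}") (auto simp: pos_divide_less_eq card_gt_0_iff)
    \<comment> \<open>Adding the pivot raises the cardinality but contributes distance 0.\<close>
    then have avg: "(\<Sum>j\<in>S. x i j) \<le> real (card S) / 4"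
      using finC iC by (simp add: S diag)
    have near: "x i j \<le> 1/2" if "j \<in> S" for j
      using that by (auto simp: S C_def relax_ball_def diag)
    have "(\<Sum>j\<in>S. wp {j, k}) \<le> 4 * (\<Sum>j\<in>S. frac_cost {j, k})" if "k \<in> U - S" for k
      using that U by (intro cut_cost[OF SV iV _ _ avg near]) (auto simp: S C_def relax_ball_def)
    then have "(\<Sum>k\<in>U - S. \<Sum>j\<in>S. wp {j, k}) \<le> 4 * (\<Sum>k\<in>U - S. \<Sum>j\<in>S. frac_cost {j, k})"
      unfolding sum_distrib_left[of 4 _ "U - S"] by (rule sum_mono)
    with joined_cost[OF finS SV iV avg near] show ?thesis
      by simp
  next
    case False
    then have S: "S = {i}"
      by (simp add: S_def pivot_cluster_def C_def Let_def)
    have "real (card C) / 4 \<le> (\<Sum>j\<in>C. x i j)"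
      using False finC by (cases "C = {}") (auto simp: pos_divide_less_eq card_gt_0_iff)
    then show ?thesis
      using singleton_cost[OF U i] by (simp add: S C_def)
  qed
qed

end

section \<open>The output of a run\<close>

lemma cluster_of_eq:
  assumes "partition_on U P" "X \<in> P" "v \<in> X"
  shows "cluster_of P v = X"
  unfolding cluster_of_def
  using assms by (intro the_equality) (auto simp: partition_on_def disjoint_def)

lemma cluster_of_mem:
  assumes "partition_on U P" "v \<in> U"
  shows "cluster_of P v \<in> P" "v \<in> cluster_of P v"
proof -
  obtain X where "X \<in> P" "v \<in> X"
    using assms by (auto simp: partition_on_def)
  then show "cluster_of P v \<in> P" "v \<in> cluster_of P v"
    using cluster_of_eq[OF assms(1)] by auto
qed

text \<open>The summand of \<open>disagree\<close> in one layer, named so that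
  \<open>sum_edges_Un\<close> applies to it.\<close>

definition pair_disagree :: "('a set \<Rightarrow> real) \<Rightarrow> ('a set \<Rightarrow> real) \<Rightarrow> 'a set set \<Rightarrow> 'a set \<Rightarrow> real"
  where "pair_disagree wp wm P e =
     wp e * on_edge (\<lambda>u v. of_bool (cluster_of P u \<noteq> cluster_of P v)) e +
     wm e * on_edge (\<lambda>u v. of_bool (cluster_of P u = cluster_of P v)) e"

lemma disagree_eq: "disagree V wp wm P l = sum (pair_disagree (wp l) (wm l) P) (edges V)"
  by (simp add: disagree_def pair_disagree_def)

lemma pair_disagree_eq:
  assumes "u \<noteq> v"
  shows "pair_disagree wp wm P {u, v} =
    (if cluster_of P u = cluster_of P v then wm {u, v} else wp {u, v})"
  using on_edge_eq[OF assms, of "\<lambda>u v. of_bool (cluster_of P u \<noteq> cluster_of P v)"]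
    on_edge_eq[OF assms, of "\<lambda>u v. of_bool (cluster_of P u = cluster_of P v)"]
  by (auto simp: pair_disagree_def)

lemma pivot_cluster_subset: "i \<in> U \<Longrightarrow> pivot_cluster x U i \<subseteq> U"
  by (auto simp: pivot_cluster_def relax_ball_def Let_def)

lemma pivot_mem_cluster: "i \<in> pivot_cluster x U i"
  by (auto simp: pivot_cluster_def Let_def)

text \<open>Induction from the end of the run. The clusters \<open>Bs0\<close> found earlier are
  arbitrary, and \<open>P\<close> collects those still to come, which partition the remaining
  vertices.\<close>

lemma (in fractional_layer) rounding_cost:
  assumes "(rounding_step x)\<^sup>*\<^sup>* (Bs0, U) (Bs, {})" "U \<subseteq> V"
  shows "\<exists>P. Bs = Bs0 \<union> P \<and> partition_on U P \<and>
    sum (pair_disagree wp wm P) (edges U) \<le> 4 * sum frac_cost (edges U)"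
  using assms
proof (induction rule: converse_rtranclp_induct2)
  case refl
  then show ?case by (simp add: partition_on_empty)
next
  case (step Bs0 U Bs1 U')
  then obtain i where i: "i \<in> U" and Bs1: "Bs1 = insert (pivot_cluster x U i) Bs0"
    and U': "U' = U - pivot_cluster x U i"
    by (auto elim: rounding_step.cases)
  define S where "S = pivot_cluster x U i"
  have S: "S \<subseteq> U" "i \<in> S" "U' = U - S"
    using i by (auto simp: S_def U' pivot_cluster_subset pivot_mem_cluster
        dest: subsetD[OF pivot_cluster_subset])
  obtain P where P: "Bs = Bs1 \<union> P" "partition_on U' P"
    and cost: "sum (pair_disagree wp wm P) (edges U') \<le> 4 * sum frac_cost (edges U')"
    using step by (auto simp: U')
  let ?Q = "insert S P"
  have part: "partition_on U ?Q"
    using P(2) S by (auto simp: partition_on_def disjoint_def)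
  have inS: "cluster_of ?Q v = S" if "v \<in> S" for v
    using that by (intro cluster_of_eq[OF part]) auto
  \<comment> \<open>Adding \<open>S\<close> leaves the clusters of later vertices unchanged, so
    their pairs keep their cost and all crossing pairs are cut.\<close>
  have outS: "cluster_of ?Q v = cluster_of P v" "cluster_of P v \<noteq> S" if "v \<in> U'" for v
    using cluster_of_mem[OF P(2) that] S that by (auto intro!: cluster_of_eq[OF part])
  have finU: "finite S" "finite U'"
    using S step.prems fin by (auto intro: finite_subset)
  have "sum (pair_disagree wp wm ?Q) (edges S) = sum wm (edges S)"
    by (intro sum.cong) (auto elim!: edgesE simp: pair_disagree_eq inS)
  moreover have "sum (pair_disagree wp wm ?Q) (edges U') = sum (pair_disagree wp wm P) (edges U')"
    by (intro sum.cong) (auto elim!: edgesE simp: pair_disagree_eq outS)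
  moreover have "(\<Sum>k\<in>U'. \<Sum>j\<in>S. pair_disagree wp wm ?Q {j, k}) = (\<Sum>k\<in>U'. \<Sum>j\<in>S. wp {j, k})"
  proof (intro sum.cong refl)
    fix k j assume "k \<in> U'" "j \<in> S"
    then show "pair_disagree wp wm ?Q {j, k} = wp {j, k}"
      using S inS[of j] outS[of k] by (subst pair_disagree_eq) auto
  qed
  moreover have "U = S \<union> U'" "S \<inter> U' = {}"
    using S by auto
  ultimately have "sum (pair_disagree wp wm ?Q) (edges U) \<le> 4 * sum frac_cost (edges U)"
    using cost pivot_cost[OF step.prems i, folded S_def, folded S(3)] sum_edges_Un[OF finU, of "pair_disagree wp wm ?Q"]
      sum_edges_Un[OF finU, of frac_cost]
    by simp
  then show ?case
    using part P(1) by (intro exI[of _ ?Q]) (auto simp: Bs1 S_def)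
qed

text \<open>Each iteration removes at least its pivot.\<close>

lemma rounding_terminates:
  assumes "finite U"
  shows "\<exists>Bs'. (rounding_step x)\<^sup>*\<^sup>* (Bs, U) (Bs', {})"
  using assms
proof (induction U arbitrary: Bs rule: finite_psubset_induct)
  case (psubset U)
  show ?case
  proof (cases "U = {}")
    case True
    then show ?thesis by auto
  next
    case False
    then obtain i where i: "i \<in> U" by blast
    let ?B = "pivot_cluster x U i"
    have "U - ?B \<subset> U"
      using i pivot_mem_cluster[of i x U] by blast
    then obtain Bs' where "(rounding_step x)\<^sup>*\<^sup>* (insert ?B Bs, U - ?B) (Bs', {})"
      using psubset.IH by blast
    moreover have "rounding_step x (Bs, U) (insert ?B Bs, U - ?B)"
      using i by (intro rounding_step.intros) auto
    ultimately show ?thesis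
      by (meson converse_rtranclp_into_rtranclp)
  qed
qed

text \<open>\<open>on_edge\<close> reads only distinct arguments, so resetting the diagonal changes
  no cost.\<close>

lemma on_edge_zero_diag:
  assumes "e \<in> edges V"
  shows "on_edge (zero_diag x) e = on_edge x e"
proof -
  have "(\<exists>u v. u \<noteq> v \<and> e = {u, v} \<and> r = zero_diag x u v) \<longleftrightarrow>
      (\<exists>u v. u \<noteq> v \<and> e = {u, v} \<and> r = x u v)" for r
    by (auto simp: zero_diag_def)
  then show ?thesis
    by (simp add: on_edge_def)
qed

lemma fractional_layer_zero_diag:
  assumes "probability_instance V L wp wm" "relax_feasible V x" "l \<in> {1..L}"
  shows "fractional_layer V (zero_diag x) (wp l) (wm l)"
proof
  have sym: "x i j = x j i" and bounds: "0 \<le> x i j" "x i j \<le> 1"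
    if "i \<in> V" "j \<in> V" "i \<noteq> j" for i j
    using assms(2) that unfolding relax_feasible_def by blast+
  have tri: "x i k \<le> x i j + x j k"
    if "i \<in> V" "j \<in> V" "k \<in> V" "i \<noteq> j" "j \<noteq> k" "i \<noteq> k" for i j k
    using assms(2) that unfolding relax_feasible_def by blast
  show "finite V"
    using assms(1) by (simp add: probability_instance_def)
  show "zero_diag x i i = 0" for i
    by (simp add: zero_diag_def)
  fix i j assume V: "i \<in> V" "j \<in> V"
  show "zero_diag x i j = zero_diag x j i"
    using sym[OF V] by (simp add: zero_diag_def)
  show "0 \<le> zero_diag x i j" "zero_diag x i j \<le> 1"
    using bounds[OF V] by (simp_all add: zero_diag_def)
  show "zero_diag x i k \<le> zero_diag x i j + zero_diag x j k" if "k \<in> V" for k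
    using V that tri[of i j k] bounds[of i j] bounds[of j k] by (auto simp: zero_diag_def)
next
  fix e assume "e \<in> edges V"
  then show "0 \<le> wp l e" "0 \<le> wm l e" "wp l e + wm l e = 1"
    using assms(1,3) by (auto simp: probability_instance_def)
qed

lemma rounding_output:
  assumes inst: "probability_instance V L wp wm" and feas: "relax_feasible V x"
    and run: "(rounding_step (zero_diag x))\<^sup>*\<^sup>* ({}, V) (Bs, {})"
    and l: "l \<in> {1..L}"
  shows "partition_on V Bs" "disagree V wp wm Bs l \<le> 4 * relax_cost V wp wm x l"
proof -
  interpret fractional_layer V "zero_diag x" "wp l" "wm l"
    using inst feas l by (rule fractional_layer_zero_diag)
  have "sum frac_cost (edges V) = relax_cost V wp wm x l"
    by (simp add: frac_cost_def relax_cost_def on_edge_zero_diag)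
  then show "partition_on V Bs" "disagree V wp wm Bs l \<le> 4 * relax_cost V wp wm x l"
    using rounding_cost[OF run order.refl] by (auto simp: disagree_eq)
qed

section \<open>The relaxation\<close>

text \<open>Monotonicity and homogeneity of the norm together; this carries the layerwise factor 4
  over to the objective.\<close>

lemma lp_norm_mono_scale:
  assumes "1 \<le> p" "L \<ge> 1" "0 \<le> c" and le: "\<And>l. l \<in> {1..L} \<Longrightarrow> 0 \<le> d l \<and> d l \<le> c * d' l"
  shows "lp_norm p L d \<le> c * lp_norm p L d'"
proof (cases "p = \<infinity>")
  case True
  have ne: "{1..L} \<noteq> {}"
    using assms by simp
  have "\<bar>d l\<bar> \<le> c * Max ((\<lambda>l. \<bar>d' l\<bar>) ` {1..L})" if "l \<in> {1..L}" for l
  proof -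
    have "\<bar>d l\<bar> \<le> c * \<bar>d' l\<bar>"
      using le[OF that] \<open>0 \<le> c\<close> by (smt (verit) mult_left_mono)
    also have "\<dots> \<le> c * Max ((\<lambda>l. \<bar>d' l\<bar>) ` {1..L})"
      using that \<open>0 \<le> c\<close> by (intro mult_left_mono Max_ge) auto
    finally show ?thesis .
  qed
  then show ?thesis
    using ne True by (simp add: lp_norm_def)
next
  case False
  define q where "q = real_of_ereal p"
  have q: "1 \<le> q"
    using assms(1) False by (cases p) (auto simp: q_def one_ereal_def)
  have "(\<Sum>l\<in>{1..L}. \<bar>d l\<bar> powr q) \<le> (\<Sum>l\<in>{1..L}. c powr q * \<bar>d' l\<bar> powr q)"
  proof (rule sum_mono)
    fix l assume l: "l \<in> {1..L}"
    have "\<bar>d l\<bar> \<le> c * \<bar>d' l\<bar>"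
      using le[OF l] \<open>0 \<le> c\<close> by (smt (verit) mult_left_mono)
    then have "\<bar>d l\<bar> powr q \<le> (c * \<bar>d' l\<bar>) powr q"
      using q by (intro powr_mono2) auto
    then show "\<bar>d l\<bar> powr q \<le> c powr q * \<bar>d' l\<bar> powr q"
      using \<open>0 \<le> c\<close> by (simp add: powr_mult)
  qed
  then have "(\<Sum>l\<in>{1..L}. \<bar>d l\<bar> powr q) powr (1/q)
      \<le> (c powr q * (\<Sum>l\<in>{1..L}. \<bar>d' l\<bar> powr q)) powr (1/q)"
    using q by (intro powr_mono2) (auto simp: sum_distrib_left intro: sum_nonneg)
  also have "\<dots> = c * (\<Sum>l\<in>{1..L}. \<bar>d' l\<bar> powr q) powr (1/q)"
    using q \<open>0 \<le> c\<close> by (simp add: powr_mult sum_nonneg powr_powr)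
  finally show ?thesis
    using False by (simp add: lp_norm_def q_def)
qed

lemma on_edge_feasible:
  assumes "relax_feasible V x" "u \<in> V" "v \<in> V" "u \<noteq> v"
  shows "on_edge x {u, v} = x u v"
proof (rule on_edge_eq)
  show "x u v = x v u"
    using assms unfolding relax_feasible_def by blast
qed (fact assms)

lemma on_edge_bounds:
  assumes "relax_feasible V x" "e \<in> edges V"
  shows "0 \<le> on_edge x e" "on_edge x e \<le> 1"
proof -
  obtain u v where e: "e = {u, v}" and uv: "u \<in> V" "v \<in> V" "u \<noteq> v"
    using assms(2) by (rule edgesE)
  have "0 \<le> x u v \<and> x u v \<le> 1"
    using assms(1) uv unfolding relax_feasible_def by blast
  then show "0 \<le> on_edge x e" "on_edge x e \<le> 1"
    using on_edge_feasible[OF assms(1) uv] e by auto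
qed

lemma relax_cost_nonneg:
  assumes "probability_instance V L wp wm" "relax_feasible V x" "l \<in> {1..L}"
  shows "0 \<le> relax_cost V wp wm x l"
  unfolding relax_cost_def using assms on_edge_bounds[OF assms(2)]
  by (intro sum_nonneg add_nonneg_nonneg mult_nonneg_nonneg) (auto simp: probability_instance_def)

text \<open>Brings both relaxations into one form, uniform in \<open>p\<close>. Costs are
  nonnegative, so the absolute values in \<open>lp_norm\<close> disappear.\<close>

lemma relax_optimal_iff:
  assumes inst: "probability_instance V L wp wm"
  shows "relax_optimal p V L wp wm x \<longleftrightarrow> relax_feasible V x \<and>
    (\<forall>y. relax_feasible V y \<longrightarrow>
      lp_norm p L (relax_cost V wp wm x) \<le> lp_norm p L (relax_cost V wp wm y))"
proof (cases "p = \<infinity>")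
  case True
  have L: "{1..L} \<noteq> {}"
    using inst by (simp add: probability_instance_def)
  define m where "m y = Max (relax_cost V wp wm y ` {1..L})" for y
  have norm: "lp_norm p L (relax_cost V wp wm y) = m y" if "relax_feasible V y" for y
    using True relax_cost_nonneg[OF inst that] by (simp add: lp_norm_def m_def cong: image_cong_simp)
  \<comment> \<open>For fixed \<open>y\<close> the least admissible bound is \<open>m y\<close>,
    which eliminates the variable \<open>t\<close> of the linear program.\<close>
  have lp: "lp_feasible V L wp wm y s \<longleftrightarrow> relax_feasible V y \<and> m y \<le> s" for y s
    using L by (simp add: lp_feasible_def m_def)
  have "relax_optimal p V L wp wm x \<longleftrightarrow>
      relax_feasible V x \<and> (\<forall>y. relax_feasible V y \<longrightarrow> m x \<le> m y)"
    using True unfolding relax_optimal_def lp_optimal_def lp by (auto intro: order_trans)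
  then show ?thesis
    using norm by auto
next
  case False
  have "lp_norm p L (relax_cost V wp wm y) = cv_objective (real_of_ereal p) V L wp wm y"
    if "relax_feasible V y" for y
    using False relax_cost_nonneg[OF inst that] by (simp add: lp_norm_def cv_objective_def)
  then show ?thesis
    using False by (auto simp: relax_optimal_def cv_optimal_def)
qed

text \<open>Having the same cluster is an equivalence relation, so its cut indicator obeys the
  triangle inequality.\<close>

lemma partition_relaxation:
  fixes wp wm :: "nat \<Rightarrow> 'a set \<Rightarrow> real"
  defines "y P \<equiv> \<lambda>u v. of_bool (cluster_of P u \<noteq> cluster_of P v)"
  shows "relax_feasible V (y P)" "relax_cost V wp wm (y P) = disagree V wp wm P"
proof -
  show "relax_feasible V (y P)"
    by (auto simp: relax_feasible_def y_def)
  have "on_edge (\<lambda>u v. of_bool (cluster_of P u = cluster_of P v)) e = 1 - on_edge (y P) e"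
    if "e \<in> edges V" for e
    using that by (elim edgesE) (simp add: y_def on_edge_eq eq_commute)
  then show "relax_cost V wp wm (y P) = disagree V wp wm P"
    by (auto simp: relax_cost_def disagree_def y_def fun_eq_iff)
qed

section \<open>Existence of an optimal fractional solution\<close>

lemma compact_power:
  fixes S :: "'b::topological_space set"
  assumes "compact S"
  shows "compact {x :: 'a \<Rightarrow> 'b. \<forall>i. x i \<in> S}"
proof -
  \<comment> \<open>Tychonoff's theorem.\<close>
  have "compactin (product_topology (\<lambda>i :: 'a. euclidean) UNIV) (\<Pi>\<^sub>E i\<in>UNIV. S)"
    using assms by (subst compactin_PiE) auto
  moreover have "(\<Pi>\<^sub>E i\<in>UNIV. S) = {x :: 'a \<Rightarrow> 'b. \<forall>i. x i \<in> S}"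
    by auto
  ultimately show ?thesis
    by (simp add: euclidean_product_topology)
qed

lemma compact_unit_box: "compact {x :: 'a \<Rightarrow> 'b \<Rightarrow> real. \<forall>i j. x i j \<in> {0..1}}"
  using compact_power[OF compact_power[OF compact_Icc[of 0 "1 :: real"]]] by simp

lemma continuous_on_apply2: "continuous_on S (\<lambda>x :: 'a \<Rightarrow> 'b \<Rightarrow> real. x i j)"
  by (rule continuous_on_product_then_coordinatewise[OF
        continuous_on_product_then_coordinatewise[OF continuous_on_id]])

lemma continuous_on_Max:
  fixes f :: "'i \<Rightarrow> 'a::topological_space \<Rightarrow> real"
  assumes "finite I" "I \<noteq> {}" "\<And>i. i \<in> I \<Longrightarrow> continuous_on S (f i)"
  shows "continuous_on S (\<lambda>x. Max ((\<lambda>i. f i x) ` I))"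
  using assms by (induction rule: finite_ne_induct) (auto intro: continuous_on_max)

lemma closed_relax_feasible: "closed {x. relax_feasible V x}"
  unfolding relax_feasible_def Ball_def
  by (intro closed_Collect_conj closed_Collect_all closed_Collect_imp
      closed_Collect_eq closed_Collect_le continuous_on_add continuous_on_const
      continuous_on_apply2 open_Collect_const)

lemma relax_optimal_exists:
  assumes p: "1 \<le> p" and inst: "probability_instance V L wp wm"
  shows "\<exists>x. relax_optimal p V L wp wm x"
proof -
  \<comment> \<open>Feasibility leaves the diagonal and indices outside \<open>V\<close> free;
    confining every coordinate to the unit interval restores compactness.\<close>
  define K where "K = {x. relax_feasible V x} \<inter> {x. \<forall>i j. x i j \<in> {0..1}}"
  have L: "{1..L} \<noteq> {}"
    using inst by (simp add: probability_instance_def)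
  have compact: "compact K"
    unfolding K_def by (intro closed_Int_compact closed_relax_feasible compact_unit_box)
  have "(\<lambda>i j. 0) \<in> K"
    by (simp add: K_def relax_feasible_def)
  then have ne: "K \<noteq> {}"
    by blast
  have cont: "continuous_on K (\<lambda>x. lp_norm p L (relax_cost V wp wm x))"
  proof -
    \<comment> \<open>\<open>on_edge\<close> is a definite description, but on symmetric points it
      is a coordinate projection.\<close>
    have "continuous_on K (\<lambda>x. on_edge x e)" if e: "e \<in> edges V" for e
    proof -
      obtain u v where "e = {u, v}" "u \<in> V" "v \<in> V" "u \<noteq> v"
        using e by (rule edgesE)
      then have "on_edge x e = x u v" if "x \<in> K" for x
        using that on_edge_feasible by (auto simp: K_def)
      then show ?thesis
        using continuous_on_apply2[of K u v] by (simp cong: continuous_on_cong)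
    qed
    then have cost: "continuous_on K (\<lambda>x. relax_cost V wp wm x l)" for l
      unfolding relax_cost_def by (intro continuous_intros)
    show ?thesis
    proof (cases "p = \<infinity>")
      case True
      then show ?thesis
        unfolding lp_norm_def using L by (auto intro!: continuous_on_Max continuous_intros cost)
    next
      case False
      define q where "q = real_of_ereal p"
      \<comment> \<open>Positive exponents are what makes \<open>powr\<close> continuous at base
        0.\<close>
      have "1 \<le> q"
        using p False by (cases p) (auto simp: q_def one_ereal_def)
      then show ?thesis
        unfolding lp_norm_def q_def[symmetric] using False
        by (auto intro!: continuous_on_powr' continuous_on_sum continuous_on_rabs
            continuous_on_const cost sum_nonneg)
    qed
  qed
  obtain x where x: "x \<in> K"
    and min: "\<forall>y\<in>K. lp_norm p L (relax_cost V wp wm x) \<le> lp_norm p L (relax_cost V wp wm y)"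
    using continuous_attains_inf[OF compact ne cont] by blast
  have "lp_norm p L (relax_cost V wp wm x) \<le> lp_norm p L (relax_cost V wp wm y)"
    if y: "relax_feasible V y" for y
  proof -
    \<comment> \<open>Zeroing the free coordinates moves \<open>y\<close> into \<open>K\<close> at
      the same cost, so a minimum over \<open>K\<close> is global.\<close>
    define y' where "y' i j = (if i \<in> V \<and> j \<in> V \<and> i \<noteq> j then y i j else 0)" for i j
    have feas: "relax_feasible V y'"
      using y unfolding relax_feasible_def y'_def by simp
    moreover have "0 \<le> y' i j \<and> y' i j \<le> 1" for i j
      using y unfolding relax_feasible_def y'_def by simp
    ultimately have "y' \<in> K"
      by (simp add: K_def)
    moreover have "on_edge y' e = on_edge y e" if "e \<in> edges V" for e
      using that by (elim edgesE) (simp add: on_edge_feasible[OF feas] on_edge_feasible[OF y] y'_def)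
    then have "relax_cost V wp wm y' = relax_cost V wp wm y"
      by (simp add: relax_cost_def fun_eq_iff)
    ultimately show ?thesis
      using min by metis
  qed
  then show ?thesis
    using x by (auto simp: relax_optimal_iff[OF inst] K_def)
qed

text \<open>The existence claim keeps the bound from being vacuous.\<close>

theorem theorem3:
  fixes p :: ereal and V :: "'a set" and L :: nat
    and wp wm :: "nat \<Rightarrow> 'a set \<Rightarrow> real"
  assumes "1 \<le> p"
    and "probability_instance V L wp wm"
  shows "(\<exists>Bs. algorithm_output p V L wp wm Bs) \<and>
         (\<forall>Bs. algorithm_output p V L wp wm Bs \<longrightarrow>
            partition_on V Bs \<and>
            lp_norm p L (disagree V wp wm Bs) \<le> 4 * opt_value p V L wp wm)"
proof (intro conjI allI impI)
  have fin: "finite V" and L: "L \<ge> 1"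
    using assms(2) by (auto simp: probability_instance_def)
  show "\<exists>Bs. algorithm_output p V L wp wm Bs"
    using relax_optimal_exists[OF assms] rounding_terminates[OF fin]
    unfolding algorithm_output_def by metis
  fix Bs assume "algorithm_output p V L wp wm Bs"
  then obtain x where opt: "relax_optimal p V L wp wm x"
    and run: "(rounding_step (zero_diag x))\<^sup>*\<^sup>* ({}, V) (Bs, {})"
    by (auto simp: algorithm_output_def)
  have feas: "relax_feasible V x"
    using opt by (simp add: relax_optimal_iff[OF assms(2)])
  note out = rounding_output[OF assms(2) feas run]
  show part: "partition_on V Bs"
    \<comment> \<open>The partition property was obtained inside a layer; \<open>L \<ge> 1\<close>
      provides layer 1.\<close>
    using out(1)[of 1] L by simp
  have "0 \<le> disagree V wp wm Bs l" if "l \<in> {1..L}" for l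
    using relax_cost_nonneg[OF assms(2) partition_relaxation(1) that]
    by (simp add: partition_relaxation(2))
  then have "lp_norm p L (disagree V wp wm Bs) \<le> 4 * lp_norm p L (relax_cost V wp wm x)"
    using out(2) assms(1) L by (intro lp_norm_mono_scale) auto
  also have "lp_norm p L (relax_cost V wp wm x) \<le> opt_value p V L wp wm"
  proof -
    have "lp_norm p L (relax_cost V wp wm x) \<le> lp_norm p L (disagree V wp wm P)" for P
      using opt partition_relaxation(1)[of V P] partition_relaxation(2)[of V wp wm P]
      by (metis relax_optimal_iff[OF assms(2)])
    then show ?thesis
      \<comment> \<open>The minimum is over a finite set, nonempty because \<open>Bs\<close> itself
        is a partition.\<close>
      using part finitely_many_partition_on[OF fin]
      by (auto simp: opt_value_def intro!: Min.boundedI)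
  qed
  finally show "lp_norm p L (disagree V wp wm Bs) \<le> 4 * opt_value p V L wp wm"
    by simp
qed

end
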